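(* Let $r\ge 3$ and $n>1$ be integers and let $j$ be permissible for $(r,n)$ with $k=1$, i.e. $r\le j\le n(r-1)+1-\lceil n/2\rceil$. Then $$F_1(r,n,j)=\sum_{i=0}^{r-2}\binom{r-1}{i}F_1(r,n-1,j-i)+\sum_{i=0}^{r-2}\binom{r-2}{i}F_1(r,n-2,j-(r-1)-i).$$
   Context: An $r$-uniform hypergraph has a vertex set and an edge set, each edge being an $r$-element set of vertices. A loose $r$-path of length $n$ is an $r$-uniform hypergraph (without isolated vertices) with $n$ edges that can be ordered $E_1,\dots,E_n$ so that $|E_i\cap E_j|=1$ if $|i-j|=1$ and $E_i\cap E_j=\emptyset$ if $|i-j|\ge 2$; it has $n(r-1)+1$ vertices. A loose $r$-path of length $0$ is a single vertex. Each vertex is colored red or blue; an edge is blue if all its vertices are blue. $F_1(r,n,j)$ is the number of red/blue colorings of the vertices (vertices are labeled) of a loose $r$-path with $n$ edges having exactly $j$ blue vertices and no blue edge; it is $0$ if $j<0$. *)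

theory Defs
  imports Complex_Main "HOL-Library.FuncSet"
begin

definition uniform_hypergraph :: "nat \<Rightarrow> 'a set \<Rightarrow> 'a set set \<Rightarrow> bool" where
  "uniform_hypergraph r V E \<longleftrightarrow> (\<forall>e\<in>E. e \<subseteq> V \<and> card e = r)"

text \<open>The condition \<open>V = \<Union>E\<close> says that there are no isolated vertices. The path of length 0 is
  an exception to it: it consists of a single vertex.\<close>

definition loose_path :: "nat \<Rightarrow> nat \<Rightarrow> 'a set \<Rightarrow> 'a set set \<Rightarrow> bool" where
  "loose_path r n V E \<longleftrightarrow>
     (if n = 0 then E = {} \<and> (\<exists>v. V = {v})
      else uniform_hypergraph r V E \<and> V = \<Union>E \<and>
        (\<exists>Es. bij_betw Es {1..n} E \<and>
           (\<forall>i\<in>{1..n}. \<forall>j\<in>{1..n}.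
              (\<bar>int i - int j\<bar> = 1 \<longrightarrow> card (Es i \<inter> Es j) = 1) \<and>
              (\<bar>int i - int j\<bar> \<ge> 2 \<longrightarrow> Es i \<inter> Es j = {}))))"

datatype color = Red | Blue

definition blue_edge :: "('a \<Rightarrow> color) \<Rightarrow> 'a set \<Rightarrow> bool" where
  "blue_edge c e \<longleftrightarrow> (\<forall>v\<in>e. c v = Blue)"

text \<open>The number of blue vertices is an integer \<open>j\<close>; for \<open>j < 0\<close> there is no such coloring.\<close>

definition colorings_no_blue_edge ::
    "'a set \<Rightarrow> 'a set set \<Rightarrow> int \<Rightarrow> ('a \<Rightarrow> color) set" where
  "colorings_no_blue_edge V E j =
     {c \<in> V \<rightarrow>\<^sub>E {Red, Blue}.
        int (card {v \<in> V. c v = Blue}) = j \<and> \<not> (\<exists>e\<in>E. blue_edge c e)}"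

text \<open>The number does not depend on the chosen path (nor on its type of vertices), and such a path
  exists for \<open>r \<ge> 2\<close>: see \<open>F1_eq\<close> and \<open>loose_path_exists\<close> below.\<close>

definition F1 :: "nat \<Rightarrow> nat \<Rightarrow> int \<Rightarrow> nat" where
  "F1 r n j =
     (let (V, E) = (SOME (V, E). loose_path r n (V :: nat set) E)
      in card (colorings_no_blue_edge V E j))"

lemma loose_path_exists:
  assumes "r \<ge> 2"
  shows "\<exists>(V :: nat set) E. loose_path r n V E"
proof (cases "n = 0")
  case True
  then show ?thesis by (auto simp: loose_path_def)
next
  case False
  define Es :: "nat \<Rightarrow> nat set" where "Es = (\<lambda>i. {(i-1)*(r-1)..i*(r-1)})"
  have card: "card (Es i) = r" if "i \<ge> 1" for i
  proof -
    obtain k where k: "i = Suc k" using \<open>i \<ge> 1\<close> by (cases i) auto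
    show ?thesis using assms by (simp add: Es_def k)
  qed
  have adj: "Es i \<inter> Es (Suc i) = {i*(r-1)}" if "i \<ge> 1" for i
    by (auto simp: Es_def)
  have far: "Es i \<inter> Es j = {}" if "i + 2 \<le> j" for i j
  proof -
    have "i * (r-1) < (j-1) * (r-1)" using that assms by (intro mult_strict_right_mono) auto
    then show ?thesis by (auto simp: Es_def)
  qed
  have ne: "Es i \<noteq> Es j" if "1 \<le> i" "i < j" for i j
  proof (cases "j = Suc i")
    case True
    show ?thesis
    proof
      assume "Es i = Es j"
      then have "Es i = {i*(r-1)}" using adj[OF that(1)] True by auto
      then show False using card[OF that(1)] assms by auto
    qed
  next
    case False
    then have "Es i \<inter> Es j = {}" using far[of i j] that by auto
    then show ?thesis using card[OF that(1)] assms by auto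
  qed
  have inj: "inj_on Es {1..n}"
    by (rule linorder_inj_onI) (use ne in auto)
  have "loose_path r n (\<Union>(Es ` {1..n})) (Es ` {1..n})"
    unfolding loose_path_def uniform_hypergraph_def
  proof (simp only: False if_False, intro conjI ballI exI[of _ Es])
    show "bij_betw Es {1..n} (Es ` {1..n})" using inj by (rule inj_on_imp_bij_betw)
    fix i j assume ij: "i \<in> {1..n}" "j \<in> {1..n}"
    show "\<bar>int i - int j\<bar> = 1 \<longrightarrow> card (Es i \<inter> Es j) = 1"
    proof
      assume "\<bar>int i - int j\<bar> = 1"
      then consider "j = Suc i" | "i = Suc j" by linarith
      then show "card (Es i \<inter> Es j) = 1"
        using adj[of i] adj[of j] ij by cases (auto simp: Int_commute)
    qed
    show "2 \<le> \<bar>int i - int j\<bar> \<longrightarrow> Es i \<inter> Es j = {}"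
    proof
      assume "2 \<le> \<bar>int i - int j\<bar>"
      then consider "i + 2 \<le> j" | "j + 2 \<le> i" by linarith
      then show "Es i \<inter> Es j = {}" using far[of i j] far[of j i] by cases auto
    qed
  qed (use card in auto)
  then show ?thesis by blast
qed

lemma bij_betw_fix_point:
  assumes "finite A" "finite B" "card A = card B" "a \<in> A" "b \<in> B"
  shows "\<exists>f. bij_betw f A B \<and> f a = b"
proof -
  have "card (A - {a}) = card (B - {b})" using assms by simp
  then obtain g where g: "bij_betw g (A - {a}) (B - {b})"
    using assms finite_same_card_bij[of "A - {a}" "B - {b}"] by auto
  have "bij_betw (g(a := b)) (A - {a} \<union> {a}) (B - {b} \<union> {b})"
  proof (rule bij_betw_combine)
    show "bij_betw (g(a := b)) (A - {a}) (B - {b})"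
      using g by (subst bij_betw_cong[of _ _ g]) auto
  qed (auto simp: bij_betw_def)
  moreover have "A - {a} \<union> {a} = A" "B - {b} \<union> {b} = B" using assms by auto
  ultimately show ?thesis by (intro exI[of _ "g(a := b)"]) simp
qed

lemma loose_path_iso_aux:
  fixes Es :: "nat \<Rightarrow> 'a set" and Fs :: "nat \<Rightarrow> 'b set"
  assumes "r \<ge> 2"
    and "\<And>i. i \<in> {1..Suc n} \<Longrightarrow> card (Es i) = r"
    and "\<And>i. i \<in> {1..n} \<Longrightarrow> card (Es i \<inter> Es (Suc i)) = 1"
    and "\<And>i j. i \<in> {1..Suc n} \<Longrightarrow> j \<in> {1..Suc n} \<Longrightarrow> i + 2 \<le> j \<Longrightarrow> Es i \<inter> Es j = {}"
    and "\<And>i. i \<in> {1..Suc n} \<Longrightarrow> card (Fs i) = r"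
    and "\<And>i. i \<in> {1..n} \<Longrightarrow> card (Fs i \<inter> Fs (Suc i)) = 1"
    and "\<And>i j. i \<in> {1..Suc n} \<Longrightarrow> j \<in> {1..Suc n} \<Longrightarrow> i + 2 \<le> j \<Longrightarrow> Fs i \<inter> Fs j = {}"
    and "u \<in> Es (Suc n)" "n \<ge> 1 \<Longrightarrow> u \<notin> Es n"
    and "v \<in> Fs (Suc n)" "n \<ge> 1 \<Longrightarrow> v \<notin> Fs n"
  shows "\<exists>f. bij_betw f (\<Union>(Es ` {1..Suc n})) (\<Union>(Fs ` {1..Suc n})) \<and>
             (\<forall>i\<in>{1..Suc n}. f ` Es i = Fs i) \<and> f u = v"
  using assms(2-)
proof (induction n arbitrary: u v)
  case 0
  have cs: "card (Es 1) = r" "card (Fs 1) = r" using "0.prems"(1,4) by auto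
  then have "finite (Es 1)" "finite (Fs 1)" using assms(1) by (auto intro!: card_ge_0_finite)
  then obtain f where "bij_betw f (Es 1) (Fs 1)" "f u = v"
    using bij_betw_fix_point[of "Es 1" "Fs 1" u v] cs "0.prems"(7,9) by auto
  then show ?case by (intro exI[of _ f]) (auto simp: bij_betw_def)
next
  case (Suc n)
  obtain a where a: "Es (Suc n) \<inter> Es (Suc (Suc n)) = {a}"
    using Suc.prems(2)[of "Suc n"] by (auto simp: card_1_singleton_iff)
  obtain b where b: "Fs (Suc n) \<inter> Fs (Suc (Suc n)) = {b}"
    using Suc.prems(5)[of "Suc n"] by (auto simp: card_1_singleton_iff)
  let ?V = "\<Union>(Es ` {1..Suc n})" and ?W = "\<Union>(Fs ` {1..Suc n})"
  let ?A = "Es (Suc (Suc n))" and ?B = "Fs (Suc (Suc n))"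
  have "\<exists>f. bij_betw f ?V ?W \<and> (\<forall>i\<in>{1..Suc n}. f ` Es i = Fs i) \<and> f a = b"
  proof (rule Suc.IH)
    show "a \<notin> Es n" if "n \<ge> 1" using Suc.prems(3)[of n "Suc (Suc n)"] a that by auto
    show "b \<notin> Fs n" if "n \<ge> 1" using Suc.prems(6)[of n "Suc (Suc n)"] b that by auto
  qed (use Suc.prems(1-6) a b in auto)
  then obtain f where f: "bij_betw f ?V ?W" "\<And>i. i\<in>{1..Suc n} \<Longrightarrow> f ` Es i = Fs i" "f a = b"
    by blast
  have cs: "card ?A = r" "card ?B = r" using Suc.prems(1,4) by auto
  then have fin: "finite ?A" "finite ?B" using assms(1) by (auto intro!: card_ge_0_finite)
  have aA: "a \<in> ?A" and bB: "b \<in> ?B" using a b by auto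
  have ua: "u \<noteq> a" and vb: "v \<noteq> b" using a b Suc.prems(8,10) by auto
  obtain g where g: "bij_betw g (?A - {a}) (?B - {b})" "g u = v"
    using bij_betw_fix_point[of "?A - {a}" "?B - {b}" u v] fin cs aA bB ua vb Suc.prems(7,9)
    by auto
  have dA: "?V \<inter> (?A - {a}) = {}"
  proof -
    have "Es i \<inter> (?A - {a}) = {}" if "i \<in> {1..Suc n}" for i
      using a Suc.prems(3)[of i "Suc (Suc n)"] that by (cases "i = Suc n") auto
    then show ?thesis by blast
  qed
  have dB: "?W \<inter> (?B - {b}) = {}"
  proof -
    have "Fs i \<inter> (?B - {b}) = {}" if "i \<in> {1..Suc n}" for i
      using b Suc.prems(6)[of i "Suc (Suc n)"] that by (cases "i = Suc n") auto
    then show ?thesis by blast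
  qed
  define h where "h = (\<lambda>x. if x \<in> ?A - {a} then g x else f x)"
  have hf: "h x = f x" if "x \<in> ?V" for x using that dA by (auto simp: h_def)
  have hg: "h x = g x" if "x \<in> ?A - {a}" for x using that by (auto simp: h_def)
  have aV: "a \<in> ?V" and bW: "b \<in> ?W" using a b by auto
  have 1: "bij_betw h (?V \<union> (?A - {a})) (?W \<union> (?B - {b}))"
  proof (rule bij_betw_combine[OF _ _ dB])
    show "bij_betw h ?V ?W" using f(1) bij_betw_cong[of ?V h f] hf by blast
    show "bij_betw h (?A - {a}) (?B - {b})"
      using g(1) bij_betw_cong[of "?A - {a}" h g] hg by blast
  qed
  have set_split: "{1..Suc (Suc n)} = insert (Suc (Suc n)) {1..Suc n}" by auto
  have "?V \<union> (?A - {a}) = \<Union>(Es ` {1..Suc (Suc n)})" "?W \<union> (?B - {b}) = \<Union>(Fs ` {1..Suc (Suc n)})"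
    unfolding set_split using aV bW by auto
  moreover have "h ` Es i = Fs i" if "i \<in> {1..Suc (Suc n)}" for i
  proof (cases "i = Suc (Suc n)")
    case True
    have "h ` ?A = insert (h a) (h ` (?A - {a}))" using aA by blast
    also have "h ` (?A - {a}) = g ` (?A - {a})" using hg by (rule image_cong[OF refl])
    also have "\<dots> = ?B - {b}" using g(1) by (simp add: bij_betw_def)
    also have "h a = b" using hf[OF aV] f(3) by simp
    finally show ?thesis using bB True by auto
  next
    case False
    then have i: "i \<in> {1..Suc n}" using that by auto
    have "h ` Es i = f ` Es i" using i by (intro image_cong refl hf) auto
    then show ?thesis using f(2)[OF i] by simp
  qed
  moreover have "h u = v" using hg[of u] ua Suc.prems(7) g(2) by auto
  ultimately show ?case using 1 by (intro exI[of _ h]) auto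
qed

lemma loose_path_iso:
  assumes r: "r \<ge> 2" and V: "loose_path r n V E" and W: "loose_path r n W F"
  shows "\<exists>f. bij_betw f V W \<and> (image f) ` E = F"
proof (cases n)
  case 0
  then obtain v w where "V = {v}" "W = {w}" "E = {}" "F = {}"
    using V W by (auto simp: loose_path_def)
  then show ?thesis by (intro exI[of _ "\<lambda>_. w"]) (auto simp: bij_betw_def)
next
  case (Suc m)
  have *: "\<exists>Es. X = \<Union>(Es ` {1..n}) \<and> G = Es ` {1..n} \<and>
         (\<forall>i\<in>{1..Suc m}. card (Es i) = r) \<and> (\<forall>i\<in>{1..m}. card (Es i \<inter> Es (Suc i)) = 1) \<and>
         (\<forall>i\<in>{1..Suc m}. \<forall>j\<in>{1..Suc m}. i + 2 \<le> j \<longrightarrow> Es i \<inter> Es j = {}) \<and>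
         (\<exists>u. u \<in> Es (Suc m) \<and> (m \<ge> 1 \<longrightarrow> u \<notin> Es m))"
    if "loose_path r n X G" for X :: "'c set" and G
  proof -
    obtain Es where Es: "bij_betw Es {1..n} G" "X = \<Union>G" "uniform_hypergraph r X G"
      "\<And>i j. i\<in>{1..n} \<Longrightarrow> j\<in>{1..n} \<Longrightarrow>
              (\<bar>int i - int j\<bar> = 1 \<longrightarrow> card (Es i \<inter> Es j) = 1) \<and>
              (\<bar>int i - int j\<bar> \<ge> 2 \<longrightarrow> Es i \<inter> Es j = {})"
      using \<open>loose_path r n X G\<close> Suc unfolding loose_path_def
      by (auto simp del: One_nat_def split: if_splits)
    have G: "G = Es ` {1..n}" using Es(1) by (simp add: bij_betw_def)
    have card: "card (Es i) = r" if "i \<in> {1..Suc m}" for i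
      using Es(3) that Suc unfolding G uniform_hypergraph_def by auto
    have adj: "card (Es i \<inter> Es (Suc i)) = 1" if "i \<in> {1..m}" for i
      using Es(4)[of i "Suc i"] that Suc by auto
    have far: "Es i \<inter> Es j = {}" if "i \<in> {1..Suc m}" "j \<in> {1..Suc m}" "i + 2 \<le> j" for i j
      using Es(4)[of i j] that Suc by auto
    have "\<exists>u. u \<in> Es (Suc m) \<and> (m \<ge> 1 \<longrightarrow> u \<notin> Es m)"
    proof (cases "m \<ge> 1")
      case True
      show ?thesis
      proof (rule ccontr)
        assume "\<not> ?thesis"
        then have "Es (Suc m) = Es m \<inter> Es (Suc m)" using True by auto
        then have "card (Es (Suc m)) = 1" using adj[of m] True by auto
        then show False using card[of "Suc m"] r by auto
      qed
    next
      case False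
      have "Es (Suc m) \<noteq> {}" using card[of "Suc m"] r by auto
      then show ?thesis using False by blast
    qed
    then show ?thesis using Es(2) G card adj far by (intro exI[of _ Es]) auto
  qed
  obtain Es u where Es: "V = \<Union>(Es ` {1..n})" "E = Es ` {1..n}"
    "\<forall>i\<in>{1..Suc m}. card (Es i) = r" "\<forall>i\<in>{1..m}. card (Es i \<inter> Es (Suc i)) = 1"
    "\<forall>i\<in>{1..Suc m}. \<forall>j\<in>{1..Suc m}. i + 2 \<le> j \<longrightarrow> Es i \<inter> Es j = {}"
    "u \<in> Es (Suc m)" "m \<ge> 1 \<longrightarrow> u \<notin> Es m"
    using *[OF V] by blast
  obtain Fs v where Fs: "W = \<Union>(Fs ` {1..n})" "F = Fs ` {1..n}"
    "\<forall>i\<in>{1..Suc m}. card (Fs i) = r" "\<forall>i\<in>{1..m}. card (Fs i \<inter> Fs (Suc i)) = 1"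
    "\<forall>i\<in>{1..Suc m}. \<forall>j\<in>{1..Suc m}. i + 2 \<le> j \<longrightarrow> Fs i \<inter> Fs j = {}"
    "v \<in> Fs (Suc m)" "m \<ge> 1 \<longrightarrow> v \<notin> Fs m"
    using *[OF W] by blast
  obtain f where f: "bij_betw f (\<Union>(Es ` {1..Suc m})) (\<Union>(Fs ` {1..Suc m}))"
      "\<forall>i\<in>{1..Suc m}. f ` Es i = Fs i"
    using loose_path_iso_aux[of r m Es Fs u v] r Es(3-) Fs(3-) by blast
  have "(image f) ` E = F" unfolding Es(2) Fs(2) image_image
    using f(2) Suc by (intro image_cong) auto
  then show ?thesis using f(1) Es(1) Fs(1) Suc by auto
qed

lemma card_colorings_iso:
  assumes f: "bij_betw f V W" and E: "\<And>e. e \<in> E \<Longrightarrow> e \<subseteq> V" and F: "(image f) ` E = F"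
  shows "card (colorings_no_blue_edge V E j) = card (colorings_no_blue_edge W F j)"
proof -
  define g where "g = inv_into V f"
  have gf: "g (f x) = x" if "x \<in> V" for x using f that by (simp add: g_def bij_betw_def)
  have fg: "f (g y) = y" if "y \<in> W" for y
    using f that by (simp add: g_def bij_betw_def f_inv_into_f)
  have fV: "f x \<in> W" if "x \<in> V" for x using f that by (auto simp: bij_betw_def)
  have gW: "g y \<in> V" if "y \<in> W" for y using f that by (auto simp: g_def bij_betw_def inv_into_into)
  have col: "c \<in> X \<rightarrow>\<^sub>E {Red, Blue} \<longleftrightarrow> c \<in> extensional X" for c and X :: "'c set"
    using color.exhaust by (auto simp: PiE_def)
  have blueV: "card {v \<in> V. c v = Blue} = card {w \<in> W. c (g w) = Blue}" for c
    by (rule bij_betw_same_card[of f], rule bij_betw_byWitness[where f' = g])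
       (auto simp: gf fg fV gW)
  have blueW: "card {w \<in> W. c w = Blue} = card {v \<in> V. c (f v) = Blue}" for c
    by (rule bij_betw_same_card[of g], rule bij_betw_byWitness[where f' = f])
       (auto simp: gf fg fV gW)
  show ?thesis
  proof (rule bij_betw_same_card,
         rule bij_betw_byWitness[where f = "\<lambda>c. restrict (\<lambda>w. c (g w)) W"
                                   and f' = "\<lambda>c. restrict (\<lambda>v. c (f v)) V"])
    show "\<forall>c\<in>colorings_no_blue_edge V E j. restrict (\<lambda>v. restrict (\<lambda>w. c (g w)) W (f v)) V = c"
      by (auto simp: colorings_no_blue_edge_def col fun_eq_iff restrict_def gf fV extensional_def)
    show "\<forall>c\<in>colorings_no_blue_edge W F j. restrict (\<lambda>w. restrict (\<lambda>v. c (f v)) V (g w)) W = c"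
      by (auto simp: colorings_no_blue_edge_def col fun_eq_iff restrict_def fg gW extensional_def)
    have "blue_edge (restrict (\<lambda>w. c (g w)) W) (f ` e) \<longleftrightarrow> blue_edge c e" if "e \<in> E" for c e
      using E[OF that] fV gf by (auto simp: blue_edge_def subset_iff)
    then show "(\<lambda>c. restrict (\<lambda>w. c (g w)) W) ` colorings_no_blue_edge V E j
                 \<subseteq> colorings_no_blue_edge W F j"
      unfolding F[symmetric]
      by (auto simp: colorings_no_blue_edge_def col blueV cong: conj_cong)
    have "blue_edge (restrict (\<lambda>v. c (f v)) V) e \<longleftrightarrow> blue_edge c (f ` e)" if "e \<in> E" for c e
      using E[OF that] by (auto simp: blue_edge_def subset_iff)
    then show "(\<lambda>c. restrict (\<lambda>v. c (f v)) V) ` colorings_no_blue_edge W F j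
                 \<subseteq> colorings_no_blue_edge V E j"
      unfolding F[symmetric]
      by (auto simp: colorings_no_blue_edge_def col blueW cong: conj_cong)
  qed
qed

lemma F1_eq:
  fixes V :: "'a set"
  assumes "r \<ge> 2" "loose_path r n V E"
  shows "F1 r n j = card (colorings_no_blue_edge V E j)"
proof -
  obtain V' :: "nat set" and E' where
    VE': "(SOME (V, E). loose_path r n (V :: nat set) E) = (V', E')"
    by (cases "SOME (V, E). loose_path r n (V :: nat set) E")
  have "\<exists>p. case p of (V, E) \<Rightarrow> loose_path r n (V :: nat set) E"
    using loose_path_exists[OF assms(1), of n] by auto
  from someI_ex[OF this] have lp: "loose_path r n V' E'" unfolding VE' by simp
  obtain f where f: "bij_betw f V V'" "(image f) ` E = E'"
    using loose_path_iso[OF assms(1) assms(2) lp] by blast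
  have "e \<subseteq> V" if "e \<in> E" for e
    using assms(2) that by (auto simp: loose_path_def uniform_hypergraph_def split: if_splits)
  then have "card (colorings_no_blue_edge V E j) = card (colorings_no_blue_edge V' E' j)"
    using f by (intro card_colorings_iso)
  then show ?thesis by (simp add: F1_def VE')
qed

end

theory Submission
  imports Defs
begin

text \<open>Let \<open>v\<close> be the vertex that the last edge shares with the previous one, and split by the
  number \<open>i\<close> of blue vertices among the \<open>r - 1\<close> other vertices of the last edge. If \<open>i \<le> r - 2\<close>, the
  last edge is not blue and the remaining path of length \<open>n - 1\<close> is colored freely. If \<open>i = r - 1\<close>,
  then \<open>v\<close> is red, so the last edge but one is not blue either, and the \<open>r - 2\<close> vertices that lie in
  this edge only and the path of length \<open>n - 2\<close> are colored freely.\<close>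

text \<open>A concrete model of the loose path: consecutive edges are integer intervals meeting at
  multiples of \<open>r - 1\<close>, so the first \<open>n\<close> edges cover an initial segment
  and dropping the last edge leaves a path of the same form.\<close>

definition path_edge :: "nat \<Rightarrow> nat \<Rightarrow> nat set" where
  "path_edge r i = {(i - 1) * (r - 1)..i * (r - 1)}"

lemma card_path_edge: "r \<ge> 2 \<Longrightarrow> i \<ge> 1 \<Longrightarrow> card (path_edge r i) = r"
  by (cases i) (simp_all add: path_edge_def)

text \<open>Truncated subtraction makes \<open>path_edge r 0\<close> the singleton of 0, so the
  formula also covers \<open>i = 0\<close>.\<close>

lemma path_edge_Int_Suc: "path_edge r i \<inter> path_edge r (Suc i) = {i * (r - 1)}"
  by (cases i) (auto simp: path_edge_def)

lemma path_edge_Int_far: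
  assumes "r \<ge> 2" "i + 2 \<le> j"
  shows "path_edge r i \<inter> path_edge r j = {}"
proof -
  have "i * (r - 1) < (j - 1) * (r - 1)"
    using assms by (intro mult_strict_right_mono) auto
  then show ?thesis by (auto simp: path_edge_def)
qed

lemma inj_on_path_edge:
  assumes "r \<ge> 2"
  shows "inj_on (path_edge r) {1..}"
proof (rule linorder_inj_onI)
  fix i j :: nat assume ij: "i < j" "i \<in> {1..}" "j \<in> {1..}"
  have "i * (r - 1) < j * (r - 1)" using ij assms by (intro mult_strict_right_mono) auto
  \<comment> \<open>The right end of the later edge lies beyond the earlier edge and separates the
    two.\<close>
  then have "j * (r - 1) \<in> path_edge r j - path_edge r i" by (auto simp: path_edge_def)
  then show "path_edge r i \<noteq> path_edge r j" by blast
qed auto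

lemma Union_path_edge:
  "n > 0 \<Longrightarrow> \<Union>(path_edge r ` {1..n}) = {0..n * (r - 1)}"
proof (induction n rule: nat_induct_non_zero)
  case (Suc n)
  have "\<Union>(path_edge r ` {1..Suc n}) = {0..n * (r - 1)} \<union> path_edge r (Suc n)"
    using Suc.IH by (simp add: atLeastAtMostSuc_conv Un_commute)
  also have "\<dots> = {0..Suc n * (r - 1)}" by (auto simp: path_edge_def)
  finally show ?case .
qed (auto simp: path_edge_def)

text \<open>Through \<open>F1_eq\<close>, this replaces the arbitrarily chosen path in
  \<open>F1\<close> by the interval model.\<close>

lemma loose_path_path_edge:
  assumes "r \<ge> 2"
  shows "loose_path r n {0..n * (r - 1)} (path_edge r ` {1..n})"
proof (cases "n = 0")
  case False
  have "inj_on (path_edge r) {1..n}"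
    using inj_on_path_edge[OF assms] by (rule inj_on_subset) auto
  moreover have "uniform_hypergraph r {0..n * (r - 1)} (path_edge r ` {1..n})"
    using Union_path_edge[of n r] False card_path_edge[OF assms]
    by (auto simp: uniform_hypergraph_def)
  moreover have "card (path_edge r i \<inter> path_edge r j) = 1" if dist: "\<bar>int i - int j\<bar> = 1" for i j
  proof -
    consider "j = Suc i" | "i = Suc j" using dist by linarith
    then show ?thesis
      by cases (simp_all add: path_edge_Int_Suc Int_commute[of "path_edge r (Suc _)"])
  qed
  moreover have "path_edge r i \<inter> path_edge r j = {}" if dist: "\<bar>int i - int j\<bar> \<ge> 2" for i j
  proof -
    consider "i + 2 \<le> j" | "j + 2 \<le> i" using dist by linarith
    then show ?thesis using path_edge_Int_far[OF assms] by cases blast+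
  qed
  ultimately show ?thesis
    unfolding loose_path_def using False Union_path_edge[of n r]
    by (simp add: inj_on_imp_bij_betw exI[of _ "path_edge r"])
qed (simp add: loose_path_def)

text \<open>Sets stand for the blue vertices of a coloring. Keeping \<open>j\<close> an integer
  makes the family empty for negative \<open>j\<close> and avoids truncation when the recursion
  subtracts from it.\<close>

definition sets_of_size :: "'a set \<Rightarrow> ('a set \<Rightarrow> bool) \<Rightarrow> int \<Rightarrow> 'a set set" where
  "sets_of_size V P j = {S. S \<subseteq> V \<and> int (card S) = j \<and> P S}"

lemma finite_sets_of_size [simp]: "finite V \<Longrightarrow> finite (sets_of_size V P j)"
  by (rule finite_subset[of _ "Pow V"]) (auto simp: sets_of_size_def)

lemma card_colorings_eq_sets_of_size:
  assumes "\<And>e. e \<in> E \<Longrightarrow> e \<subseteq> V"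
  shows "card (colorings_no_blue_edge V E j) = card (sets_of_size V (\<lambda>S. \<not> (\<exists>e\<in>E. e \<subseteq> S)) j)"
proof -
  \<comment> \<open>The coloring with blue set \<open>S\<close>, made undefined outside
    \<open>V\<close> as membership in \<open>PiE\<close> demands.\<close>
  define col where "col S = restrict (\<lambda>v. if v \<in> S then Blue else Red) V" for S
  have blue_col: "{v \<in> V. col S v = Blue} = S" if "S \<subseteq> V" for S
    using that by (auto simp: col_def)
  have col_blue: "col {v \<in> V. c v = Blue} = c" if "c \<in> V \<rightarrow>\<^sub>E {Red, Blue}" for c
  proof
    fix x show "col {v \<in> V. c v = Blue} x = c x"
      using that by (cases "c x") (auto simp: col_def PiE_def extensional_def)
  qed
  have blue_edge_iff: "blue_edge c e \<longleftrightarrow> e \<subseteq> {v \<in> V. c v = Blue}" if "e \<in> E" for c e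
    using assms[OF that] by (auto simp: blue_edge_def)
  have no_blue: "(\<exists>e\<in>E. blue_edge c e) \<longleftrightarrow> (\<exists>e\<in>E. e \<subseteq> {v \<in> V. c v = Blue})" for c
    using blue_edge_iff by blast
  have col_PiE: "col S \<in> V \<rightarrow>\<^sub>E {Red, Blue}" for S by (simp add: col_def)
  have "bij_betw (\<lambda>c. {v \<in> V. c v = Blue}) (colorings_no_blue_edge V E j)
          (sets_of_size V (\<lambda>S. \<not> (\<exists>e\<in>E. e \<subseteq> S)) j)"
  proof (rule bij_betw_byWitness[where f' = col])
    show "(\<lambda>c. {v \<in> V. c v = Blue}) ` colorings_no_blue_edge V E j
            \<subseteq> sets_of_size V (\<lambda>S. \<not> (\<exists>e\<in>E. e \<subseteq> S)) j"
      by (force simp: colorings_no_blue_edge_def sets_of_size_def no_blue)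
    show "col ` sets_of_size V (\<lambda>S. \<not> (\<exists>e\<in>E. e \<subseteq> S)) j \<subseteq> colorings_no_blue_edge V E j"
      using col_PiE by (auto simp: colorings_no_blue_edge_def sets_of_size_def no_blue blue_col)
  qed (auto simp: colorings_no_blue_edge_def sets_of_size_def col_blue blue_col)
  then show ?thesis by (rule bij_betw_same_card)
qed

text \<open>The traces of \<open>S\<close> on \<open>A\<close> and on \<open>W\<close> are chosen
  independently: the condition sees only the size of the first, and size \<open>i\<close> there
  leaves \<open>j - i\<close> elements for the second.\<close>

lemma card_sets_of_size_Un:
  assumes "finite W" "finite A" "W \<inter> A = {}" "finite I"
  shows "card (sets_of_size (W \<union> A) (\<lambda>S. card (S \<inter> A) \<in> I \<and> P (S \<inter> W)) j)
       = (\<Sum>i\<in>I. (card A choose i) * card (sets_of_size W P (j - int i)))"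
proof -
  \<comment> \<open>For each size \<open>i\<close>, the pairs of traces; carrying \<open>i\<close>
    along as a component lets \<open>card_SigmaI\<close> produce the sum.\<close>
  let ?D = "\<lambda>i. {B. B \<subseteq> A \<and> card B = i} \<times> sets_of_size W P (j - int i)"
  have card_Un: "card (B \<union> T) = card B + card T" if "B \<subseteq> A" "T \<subseteq> W" for B T
    using that assms by (intro card_Un_disjoint) (auto intro: finite_subset)
  have restr: "(B \<union> T) \<inter> A = B" "(B \<union> T) \<inter> W = T" if "B \<subseteq> A" "T \<subseteq> W" for B T
    using that assms(3) by auto
  have split: "S \<inter> A \<union> S \<inter> W = S" if "S \<subseteq> W \<union> A" for S using that by auto
  have card_split: "int (card (S \<inter> W)) = int (card S) - int (card (S \<inter> A))" if "S \<subseteq> W \<union> A" for S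
    using card_Un[of "S \<inter> A" "S \<inter> W"] split[OF that] by simp
  have "bij_betw (\<lambda>(i, B, T). B \<union> T) (Sigma I ?D)
          (sets_of_size (W \<union> A) (\<lambda>S. card (S \<inter> A) \<in> I \<and> P (S \<inter> W)) j)"
    by (rule bij_betw_byWitness[where f' = "\<lambda>S. (card (S \<inter> A), S \<inter> A, S \<inter> W)"])
       (auto simp: sets_of_size_def card_Un restr split card_split)
  then have "card (sets_of_size (W \<union> A) (\<lambda>S. card (S \<inter> A) \<in> I \<and> P (S \<inter> W)) j)
           = card (Sigma I ?D)"
    by (rule bij_betw_same_card[symmetric])
  also have "\<dots> = (\<Sum>i\<in>I. card (?D i))"
    using assms by (intro card_SigmaI) auto
  also have "\<dots> = (\<Sum>i\<in>I. (card A choose i) * card (sets_of_size W P (j - int i)))"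
    using assms by (simp add: card_cartesian_product n_subsets)
  finally show ?thesis .
qed

text \<open>\<open>S\<close> may reach beyond the first \<open>n\<close> edges, so one set can be
  tested against paths of different lengths.\<close>

definition edge_free :: "nat \<Rightarrow> nat \<Rightarrow> nat set \<Rightarrow> bool" where
  "edge_free r n S \<longleftrightarrow> \<not> (\<exists>i\<in>{1..n}. path_edge r i \<subseteq> S)"

lemma F1_eq_card_sets_of_size:
  assumes "r \<ge> 2"
  shows "F1 r n j = card (sets_of_size {0..n * (r - 1)} (edge_free r n) j)"
proof -
  have "e \<subseteq> {0..n * (r - 1)}" if "e \<in> path_edge r ` {1..n}" for e
    using Union_path_edge[of n r] that by fastforce
  then show ?thesis
    unfolding F1_eq[OF assms loose_path_path_edge[OF assms]]
    by (subst card_colorings_eq_sets_of_size) (simp_all add: edge_free_def [abs_def])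
qed

lemma edge_free_Suc:
  "edge_free r (Suc n) S \<longleftrightarrow> edge_free r n S \<and> \<not> path_edge r (Suc n) \<subseteq> S"
  by (auto simp: edge_free_def atLeastAtMostSuc_conv)

lemma edge_free_Int: "edge_free r n (S \<inter> {0..n * (r - 1)}) = edge_free r n S"
proof -
  have "path_edge r i \<subseteq> {0..n * (r - 1)}" if "i \<in> {1..n}" for i
    using Union_path_edge[of n r] that by fastforce
  then show ?thesis unfolding edge_free_def le_inf_iff by blast
qed

lemma path_edge_Suc_eq:
  "path_edge r (Suc n) = insert (n * (r - 1)) {n * (r - 1)<..Suc n * (r - 1)}"
  by (auto simp: path_edge_def)

text \<open>A red final vertex already keeps the last edge from being blue, so its
  \<open>r - 2\<close> inner vertices are free and the first \<open>n\<close> edges carry the only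
  remaining constraint.\<close>

lemma card_edge_free_last_red:
  assumes "r \<ge> 2"
  shows "card (sets_of_size {0..Suc n * (r - 1)}
            (\<lambda>S. Suc n * (r - 1) \<notin> S \<and> edge_free r (Suc n) S) j)
       = (\<Sum>i=0..r-2. ((r-2) choose i) * F1 r n (j - int i))"
proof -
  let ?W = "{0..n * (r - 1)}" and ?A = "{n * (r - 1)<..<Suc n * (r - 1)}"
  have card_A: "card ?A = r - 2" using assms by simp
  have last: "Suc n * (r - 1) \<in> path_edge r (Suc n)" by (simp add: path_edge_def)
  have vertices: "S \<subseteq> {0..Suc n * (r - 1)} \<and> Suc n * (r - 1) \<notin> S \<longleftrightarrow> S \<subseteq> ?W \<union> ?A" for S
  proof -
    have "?W \<union> ?A = {0..Suc n * (r - 1)} - {Suc n * (r - 1)}" using assms by auto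
    then show ?thesis by blast
  qed
  \<comment> \<open>This always holds; it is inserted to match the form of
    \<open>card_sets_of_size_Un\<close>.\<close>
  have "card (S \<inter> ?A) \<in> {0..r-2}" for S
    using card_mono[of ?A "S \<inter> ?A"] card_A by simp
  then have "sets_of_size {0..Suc n * (r - 1)}
            (\<lambda>S. Suc n * (r - 1) \<notin> S \<and> edge_free r (Suc n) S) j
      = sets_of_size (?W \<union> ?A) (\<lambda>S. card (S \<inter> ?A) \<in> {0..r-2} \<and> edge_free r n (S \<inter> ?W)) j"
    using last vertices unfolding sets_of_size_def edge_free_Int edge_free_Suc by blast
  moreover have "card (sets_of_size (?W \<union> ?A)
      (\<lambda>S. card (S \<inter> ?A) \<in> {0..r-2} \<and> edge_free r n (S \<inter> ?W)) j)
      = (\<Sum>i=0..r-2. ((r-2) choose i) * F1 r n (j - int i))"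
    unfolding F1_eq_card_sets_of_size[OF assms] card_A[symmetric]
    by (rule card_sets_of_size_Un) auto
  ultimately show ?thesis by (simp only:)
qed

text \<open>If some vertex of the last edge after \<open>n * (r - 1)\<close> is red, that edge is
  harmless. If all \<open>r - 1\<close> of them are blue, the vertex \<open>n * (r - 1)\<close> must
  be red, which gives the extra term.\<close>

lemma F1_Suc:
  assumes "r \<ge> 2"
  shows "F1 r (Suc n) j = (\<Sum>i=0..r-2. ((r-1) choose i) * F1 r n (j - int i))
    + card (sets_of_size {0..n * (r - 1)} (\<lambda>S. n * (r - 1) \<notin> S \<and> edge_free r n S)
        (j - (int r - 1)))"
proof -
  let ?v = "n * (r - 1)"
  let ?W = "{0..?v}" and ?A = "{?v<..Suc n * (r - 1)}"
  let ?X = "sets_of_size (?W \<union> ?A)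
      (\<lambda>S. card (S \<inter> ?A) \<in> {0..r-2} \<and> edge_free r n (S \<inter> ?W)) j"
  let ?Y = "sets_of_size (?W \<union> ?A)
      (\<lambda>S. card (S \<inter> ?A) \<in> {r-1} \<and> (?v \<notin> S \<inter> ?W \<and> edge_free r n (S \<inter> ?W))) j"
  have card_A: "card ?A = r - 1" by simp
  have V: "{0..Suc n * (r - 1)} = ?W \<union> ?A" by auto
  have full: "card (S \<inter> ?A) = r - 1 \<longleftrightarrow> ?A \<subseteq> S" for S
    using card_subset_eq[of ?A "S \<inter> ?A"] card_A by (auto simp: inf.absorb2)
  have le: "card (S \<inter> ?A) \<le> r - 1" for S
    using card_mono[of ?A "S \<inter> ?A"] card_A by simp
  have not_full: "card (S \<inter> ?A) \<in> {0..r-2} \<longleftrightarrow> \<not> ?A \<subseteq> S" for S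
    unfolding full[symmetric] atLeastAtMost_iff using le[of S] assms by linarith
  have full': "card (S \<inter> ?A) \<in> {r-1} \<longleftrightarrow> ?A \<subseteq> S" for S
    using full by blast
  have v: "?v \<notin> S \<inter> ?W \<longleftrightarrow> ?v \<notin> S" for S by simp
  have "sets_of_size {0..Suc n * (r - 1)} (edge_free r (Suc n)) j = ?X \<union> ?Y"
    unfolding sets_of_size_def V edge_free_Int edge_free_Suc path_edge_Suc_eq not_full full' v
    by blast
  moreover have "?X \<inter> ?Y = {}"
    unfolding sets_of_size_def not_full full' by blast
  ultimately have "F1 r (Suc n) j = card ?X + card ?Y"
    unfolding F1_eq_card_sets_of_size[OF assms]
    by (simp add: card_Un_disjoint del: Un_iff)
  moreover have "card ?X = (\<Sum>i=0..r-2. ((r-1) choose i) * F1 r n (j - int i))"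
    unfolding F1_eq_card_sets_of_size[OF assms]
    by (subst card_sets_of_size_Un) (auto simp only: card_A finite_atLeastAtMost
      finite_greaterThanAtMost Int_iff atLeastAtMost_iff greaterThanAtMost_iff not_le)
  \<comment> \<open>The index set is a singleton, and its only binomial coefficient,
    \<open>(r-1) choose (r-1)\<close>, is 1.\<close>
  moreover have "card ?Y = card (sets_of_size ?W (\<lambda>S. ?v \<notin> S \<and> edge_free r n S)
      (j - (int r - 1)))"
    using assms by (subst card_sets_of_size_Un) (auto simp: of_nat_diff)
  ultimately show ?thesis by (simp only:)
qed

theorem theorem3p7:
  fixes r n :: nat and j :: int
  assumes "r \<ge> 3" and "n > 1"
    and "int r \<le> j" and "j \<le> int n * (int r - 1) + 1 - \<lceil>real n / 2\<rceil>"
  shows "F1 r n j =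
      (\<Sum>i=0..r-2. ((r-1) choose i) * F1 r (n-1) (j - int i))
    + (\<Sum>i=0..r-2. ((r-2) choose i) * F1 r (n-2) (j - (int r - 1) - int i))"
proof -
  obtain k where n: "n = Suc (Suc k)" using \<open>n > 1\<close> by (auto dest: less_imp_Suc_add)
  have r: "r \<ge> 2" using \<open>r \<ge> 3\<close> by simp
  have "n - 1 = Suc k" "n - 2 = k" by (simp_all add: n)
  \<comment> \<open>After the last edge is removed, the extra term counts sets on a path with
    \<open>k + 1\<close> edges whose final vertex is red; \<open>card_edge_free_last_red\<close>
    reduces it to \<open>k = n - 2\<close> edges.\<close>
  then show ?thesis
    unfolding F1_Suc[OF r, of "Suc k" j, folded n] card_edge_free_last_red[OF r] by (simp only:)
qed

end
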